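(* Let $R,\Lambda$ be positive integers and $w$ a positive integer. Suppose there exists a $\mathrm{DK}(R,\Lambda)$-design on $V$ points with $B$ blocks such that the size of every block is congruent to $w-1$ modulo $w$. Suppose furthermore that at least one of $RB$ or $B^2$ is not divisible by $w$. Then there exists a type-maximal set of $V$ mutually orthogonal binary frequency squares of type $(B+VR;\,B+VR-R,\,R)$.
   Context: A design is a pair $(\mathcal{V},\mathcal{B})$ with $\mathcal{V}$ a finite set of points and $\mathcal{B}$ a collection (multiset; repeated and empty blocks allowed) of subsets of $\mathcal{V}$. A $\mathrm{DK}(R,\Lambda)$-design is a design in which every pair of distinct points occurs in exactly $\Lambda$ blocks, every point occurs in exactly $R$ blocks, and $R^2=\Lambda|\mathcal{B}|$. A frequency square of type $(N;\mu_0,\dots,\mu_{m-1})$ ($m\ge2$, $\mu_i\ge1$) is an $N\times N$ array on symbols $\{0,\dots,m-1\}$ where symbol $i$ occurs exactly $\mu_i$ times in each row and column; binary means $m=2$. Two frequency squares of types $(N;\mu_0,\dots)$ and $(N;\nu_0,\dots)$ are orthogonal if each ordered pair $(i,j)$ occurs exactly $\mu_i\nu_j$ times when superimposed. A set $\{F_1,\dots,F_k\}$ of mutually (pairwise) orthogonal frequency squares is type-maximal if there is no frequency square $F$ orthogonal to every $F_i$ and of the same type as some $F_t$. *)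

theory Defs
  imports
    "HOL-Library.Multiset"
    "HOL-Number_Theory.Cong"
    "Jordan_Normal_Form.Matrix"
begin

definition design :: "'a set \<Rightarrow> 'a set multiset \<Rightarrow> bool" where
  "design \<V> \<B> \<longleftrightarrow> finite \<V> \<and> (\<forall>b\<in>#\<B>. b \<subseteq> \<V>)"

definition DK_design :: "nat \<Rightarrow> nat \<Rightarrow> 'a set \<Rightarrow> 'a set multiset \<Rightarrow> bool" where
  "DK_design R \<Lambda> \<V> \<B> \<longleftrightarrow>
     design \<V> \<B> \<and>
     (\<forall>x\<in>\<V>. \<forall>y\<in>\<V>. x \<noteq> y \<longrightarrow> size {#b \<in># \<B>. x \<in> b \<and> y \<in> b#} = \<Lambda>) \<and>
     (\<forall>x\<in>\<V>. size {#b \<in># \<B>. x \<in> b#} = R) \<and>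
     R\<^sup>2 = \<Lambda> * size \<B>"

text \<open>The type \<open>(N; \<mu>\<^sub>0, \<dots>, \<mu>\<^sub>m\<^sub>-\<^sub>1)\<close> is given by \<open>N\<close> and the list \<open>\<mu>\<close> of length \<open>m\<close>.
  Since \<open>0 < N\<close> and all frequencies are positive, a square has at most one type.\<close>

definition frequency_square :: "nat \<Rightarrow> nat list \<Rightarrow> nat mat \<Rightarrow> bool" where
  "frequency_square N \<mu> F \<longleftrightarrow>
     0 < N \<and> 2 \<le> length \<mu> \<and> (\<forall>k<length \<mu>. 1 \<le> \<mu> ! k) \<and>
     F \<in> carrier_mat N N \<and>
     (\<forall>r<N. \<forall>c<N. F $$ (r, c) < length \<mu>) \<and>
     (\<forall>k<length \<mu>. \<forall>r<N. card {c. c < N \<and> F $$ (r, c) = k} = \<mu> ! k) \<and>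
     (\<forall>k<length \<mu>. \<forall>c<N. card {r. r < N \<and> F $$ (r, c) = k} = \<mu> ! k)"

definition fs_orthogonal :: "nat \<Rightarrow> nat mat \<Rightarrow> nat mat \<Rightarrow> bool" where
  "fs_orthogonal N F G \<longleftrightarrow>
     (\<exists>\<mu> \<nu>. frequency_square N \<mu> F \<and> frequency_square N \<nu> G \<and>
        (\<forall>i<length \<mu>. \<forall>j<length \<nu>.
           card {(r, c). r < N \<and> c < N \<and> F $$ (r, c) = i \<and> G $$ (r, c) = j} = \<mu> ! i * \<nu> ! j))"

definition mutually_orthogonal_fs :: "nat \<Rightarrow> nat mat set \<Rightarrow> bool" where
  "mutually_orthogonal_fs N S \<longleftrightarrow>
     finite S \<and> (\<forall>F\<in>S. \<exists>\<mu>. frequency_square N \<mu> F) \<and> pairwise (fs_orthogonal N) S"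

definition type_maximal :: "nat \<Rightarrow> nat mat set \<Rightarrow> bool" where
  "type_maximal N S \<longleftrightarrow>
     mutually_orthogonal_fs N S \<and>
     \<not> (\<exists>F \<mu>. frequency_square N \<mu> F \<and> (\<exists>G\<in>S. frequency_square N \<mu> G) \<and>
            (\<forall>G\<in>S. fs_orthogonal N F G))"

end

theory Submission
  imports Defs
begin

text \<open>
  Put the \<open>B\<close> blocks into a cyclic Latin square of order \<open>B\<close>, occupying the top left corner of an
  array of order \<open>B + V * R\<close>, and partition the bottom right corner cyclically into \<open>V\<close> classes with
  \<open>R\<close> cells of each class in every line, one class for each point. The square of a point \<open>x\<close> has its
  ones at the blocks through \<open>x\<close> and at the cells of the class of \<open>x\<close>. Two such squares share
  \<open>\<Lambda> * B = R\<^sup>2\<close> ones, all in the top left corner.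

  Suppose \<open>G\<close> has the same type and is orthogonal to all these squares. Counting the common
  ones of \<open>G\<close> with all squares gives \<open>T + D = V * R\<^sup>2\<close>, where \<open>T\<close> is the sum of the block sizes over
  the ones of \<open>G\<close> in the top left corner and \<open>D\<close> is the number of ones of \<open>G\<close> in the bottom right
  corner. If \<open>a\<close> is the number of ones of \<open>G\<close> in the top left corner, then
  \<open>D + R * B = a + V * R\<^sup>2\<close>, whence \<open>T + a = R * B\<close>. Every block size is \<open>-1\<close> modulo \<open>w\<close>, so \<open>w\<close>
  divides \<open>T + a\<close>. Summing the block sizes shows that \<open>w\<close> also divides \<open>B + V * R\<close>, and hence \<open>B\<^sup>2\<close>.
\<close>

section \<open>Binary frequency squares as zero-one matrices\<close>

text \<open>If one type had more symbols, its first surplus symbol would have positive frequency in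
  row \<open>0\<close>, while the other type bounds all entries below it. Uniqueness matters because
  \<open>fs_orthogonal\<close> and \<open>type_maximal\<close> quantify over types
  existentially.\<close>

lemma frequency_square_type_unique:
  assumes F: "frequency_square N \<mu> F" and F': "frequency_square N \<nu> F"
  shows "\<mu> = \<nu>"
proof -
  have N: "0 < N" using F by (simp add: frequency_square_def)
  have le: "length \<alpha> \<le> length \<beta>"
    if \<alpha>: "frequency_square N \<alpha> F" and \<beta>: "frequency_square N \<beta> F" for \<alpha> \<beta>
  proof (rule ccontr)
    assume "\<not> length \<alpha> \<le> length \<beta>"
    then have "length \<beta> < length \<alpha>" by simp
    with \<alpha> N have "1 \<le> card {c. c < N \<and> F $$ (0, c) = length \<beta>}"
      by (auto simp: frequency_square_def)
    then have "{c. c < N \<and> F $$ (0, c) = length \<beta>} \<noteq> {}"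
      by (metis card.empty not_one_le_zero)
    then obtain c where "c < N" "F $$ (0, c) = length \<beta>" by blast
    with \<beta> N show False unfolding frequency_square_def by (metis less_irrefl)
  qed
  show ?thesis
  proof (rule nth_equalityI)
    show "length \<mu> = length \<nu>" using le F F' by (simp add: eq_iff)
    then show "\<mu> ! k = \<nu> ! k" if "k < length \<mu>" for k
      using F F' N that unfolding frequency_square_def by metis
  qed
qed

lemma card_eq_one_sum:
  fixes f :: "'b \<Rightarrow> nat"
  assumes "finite A" and "\<And>c. c \<in> A \<Longrightarrow> f c \<le> 1"
  shows "card {c \<in> A. f c = 1} = sum f A"
proof -
  have "card {c \<in> A. f c = 1} = (\<Sum>c\<in>A. of_bool (f c = 1))"
    using assms(1) by (simp add: Int_def)
  also have "\<dots> = sum f A"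
    using assms(2) by (intro sum.cong) (auto simp: le_Suc_eq)
  finally show ?thesis .
qed

lemma card_eq_zero_diff:
  fixes f :: "'b \<Rightarrow> nat"
  assumes "finite A" and "\<And>c. c \<in> A \<Longrightarrow> f c \<le> 1"
  shows "card {c \<in> A. f c = 0} = card A - sum f A"
proof -
  have "{c \<in> A. f c = 0} = A - {c \<in> A. f c = 1}"
    using assms(2) by (auto simp: le_Suc_eq)
  with assms show ?thesis
    by (simp add: card_Diff_subset card_eq_one_sum[symmetric])
qed

text \<open>With entries at most 1, a line sum counts the ones of that line, and the count of zeros
  is its complement.\<close>

lemma binary_frequency_square_iff:
  assumes "0 < R" "R < N"
  shows "frequency_square N [N - R, R] F \<longleftrightarrow>
    F \<in> carrier_mat N N \<and> (\<forall>r<N. \<forall>c<N. F $$ (r, c) \<le> 1) \<and>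
    (\<forall>r<N. (\<Sum>c<N. F $$ (r, c)) = R) \<and> (\<forall>c<N. (\<Sum>r<N. F $$ (r, c)) = R)"
proof -
  have row: "card {c. c < N \<and> F $$ (r, c) = 1} = (\<Sum>c<N. F $$ (r, c))"
       "card {c. c < N \<and> F $$ (r, c) = 0} = N - (\<Sum>c<N. F $$ (r, c))"
    if "r < N" "\<forall>r<N. \<forall>c<N. F $$ (r, c) \<le> 1" for r
    using card_eq_one_sum[of "{..<N}" "\<lambda>c. F $$ (r, c)"]
      card_eq_zero_diff[of "{..<N}" "\<lambda>c. F $$ (r, c)"] that by simp_all
  have col: "card {r. r < N \<and> F $$ (r, c) = 1} = (\<Sum>r<N. F $$ (r, c))"
       "card {r. r < N \<and> F $$ (r, c) = 0} = N - (\<Sum>r<N. F $$ (r, c))"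
    if "c < N" "\<forall>r<N. \<forall>c<N. F $$ (r, c) \<le> 1" for c
    using card_eq_one_sum[of "{..<N}" "\<lambda>r. F $$ (r, c)"]
      card_eq_zero_diff[of "{..<N}" "\<lambda>r. F $$ (r, c)"] that by simp_all
  have two: "(\<forall>k<length [N - R, R]. P k) \<longleftrightarrow> P 0 \<and> P 1" for P
    by (auto simp: less_Suc_eq)
  have "F $$ (r, c) < length [N - R, R] \<longleftrightarrow> F $$ (r, c) \<le> 1" for r c
    by auto
  then have "frequency_square N [N - R, R] F \<longleftrightarrow>
    F \<in> carrier_mat N N \<and> (\<forall>r<N. \<forall>c<N. F $$ (r, c) \<le> 1) \<and>
    (\<forall>r<N. card {c. c < N \<and> F $$ (r, c) = 0} = N - R) \<and>
    (\<forall>r<N. card {c. c < N \<and> F $$ (r, c) = 1} = R) \<and>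
    (\<forall>c<N. card {r. r < N \<and> F $$ (r, c) = 0} = N - R) \<and>
    (\<forall>c<N. card {r. r < N \<and> F $$ (r, c) = 1} = R)"
    using assms unfolding frequency_square_def two by (simp add: Suc_le_eq)
  then show ?thesis
    by (simp add: row col del: One_nat_def cong: conj_cong) auto
qed

text \<open>The number of occurrences of each symbol in either square is known, so the count of one
  pair determines the other three.\<close>

lemma binary_orthogonal_iff:
  assumes "0 < R" "R < N"
    and F: "frequency_square N [N - R, R] F" and G: "frequency_square N [N - R, R] G"
  shows "fs_orthogonal N F G \<longleftrightarrow> (\<Sum>r<N. \<Sum>c<N. F $$ (r, c) * G $$ (r, c)) = R * R"
proof -
  note F' = F[unfolded binary_frequency_square_iff[OF assms(1,2)]]
  note G' = G[unfolded binary_frequency_square_iff[OF assms(1,2)]]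
  let ?n = "\<lambda>i j. card {(r, c). r < N \<and> c < N \<and> F $$ (r, c) = i \<and> G $$ (r, c) = j}"
  have fin: "finite {(r, c). r < N \<and> c < N \<and> P r c}" for P
    by (rule finite_subset[of _ "{..<N} \<times> {..<N}"]) auto
  have one: "?n 1 1 = (\<Sum>r<N. \<Sum>c<N. F $$ (r, c) * G $$ (r, c))"
  proof -
    have "?n 1 1 = card {p \<in> {..<N} \<times> {..<N}. F $$ p * G $$ p = 1}"
      by (rule arg_cong[where f = card]) auto
    also have "\<dots> = (\<Sum>p\<in>{..<N} \<times> {..<N}. F $$ p * G $$ p)"
    proof (rule card_eq_one_sum)
      show "F $$ p * G $$ p \<le> 1" if "p \<in> {..<N} \<times> {..<N}" for p
        using F' G' that mult_le_one[of "F $$ p" "G $$ p"] by (cases p) auto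
    qed simp
    finally show ?thesis by (simp add: sum.cartesian_product case_prod_unfold)
  qed
  have total: "card {(r, c). r < N \<and> c < N \<and> H $$ (r, c) = k} = N * [N - R, R] ! k"
    if "frequency_square N [N - R, R] H" "k < 2" for H k
  proof -
    have "{(r, c). r < N \<and> c < N \<and> H $$ (r, c) = k}
        = (SIGMA r:{..<N}. {c. c < N \<and> H $$ (r, c) = k})" by auto
    then show ?thesis using that by (simp add: frequency_square_def)
  qed
  have splitF: "?n 0 j + ?n 1 j = N * [N - R, R] ! j" if "j < 2" for j
  proof -
    have "{(r, c). r < N \<and> c < N \<and> G $$ (r, c) = j} =
       {(r, c). r < N \<and> c < N \<and> F $$ (r, c) = 0 \<and> G $$ (r, c) = j} \<union>
       {(r, c). r < N \<and> c < N \<and> F $$ (r, c) = 1 \<and> G $$ (r, c) = j}"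
      using F' by (auto simp: le_Suc_eq)
    moreover have "card \<dots> = ?n 0 j + ?n 1 j"
      by (rule card_Un_disjoint) (use fin in auto)
    ultimately show ?thesis using total[OF G that] by simp
  qed
  have splitG: "?n i 0 + ?n i 1 = N * [N - R, R] ! i" if "i < 2" for i
  proof -
    have "{(r, c). r < N \<and> c < N \<and> F $$ (r, c) = i} =
       {(r, c). r < N \<and> c < N \<and> F $$ (r, c) = i \<and> G $$ (r, c) = 0} \<union>
       {(r, c). r < N \<and> c < N \<and> F $$ (r, c) = i \<and> G $$ (r, c) = 1}"
      using G' by (auto simp: le_Suc_eq)
    moreover have "card \<dots> = ?n i 0 + ?n i 1"
      by (rule card_Un_disjoint) (use fin in auto)
    ultimately show ?thesis using total[OF F that] by simp
  qed
  \<comment> \<open>Writing \<open>N\<close> as \<open>R + d\<close> removes truncated subtraction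
    from the arithmetic below.\<close>
  obtain d where d: "N = R + d" using assms(2) less_imp_add_positive by blast
  have "fs_orthogonal N F G \<longleftrightarrow>
      (\<forall>i<2. \<forall>j<2. ?n i j = [N - R, R] ! i * [N - R, R] ! j)"
  proof -
    have "frequency_square N \<mu> F \<longleftrightarrow> \<mu> = [N - R, R]"
      and "frequency_square N \<mu> G \<longleftrightarrow> \<mu> = [N - R, R]" for \<mu>
      using F G frequency_square_type_unique by blast+
    then show ?thesis by (simp add: fs_orthogonal_def numeral_2_eq_2)
  qed
  also have "\<dots> \<longleftrightarrow> ?n 1 1 = R * R"
  proof
    assume *: "?n 1 1 = R * R"
    have 01: "?n 0 1 = d * R" using splitF[of 1] * d by (simp add: algebra_simps)
    have 10: "?n 1 0 = R * d" using splitG[of 1] * d by (simp add: algebra_simps)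
    have 00: "?n 0 0 = d * d" using splitG[of 0] 01 d by (simp add: algebra_simps)
    show "\<forall>i<2. \<forall>j<2. ?n i j = [N - R, R] ! i * [N - R, R] ! j"
      using 00 01 10 * d by (auto simp: less_Suc_eq numeral_2_eq_2)
  qed auto
  finally show ?thesis by (simp only: one)
qed

section \<open>Cyclic arrays\<close>

text \<open>Moving the window one step drops \<open>f (a mod m)\<close> on the left and gains the
  same value on the right.\<close>

lemma sum_mod_period:
  fixes f :: "nat \<Rightarrow> nat"
  shows "(\<Sum>c=a..<a + m. f (c mod m)) = (\<Sum>k<m. f k)"
proof (induction a)
  case 0
  show ?case by (simp add: lessThan_atLeast0)
next
  case (Suc a)
  show ?case
  proof (cases "m = 0")
    case False
    then have "(\<Sum>c=a..<a + m. f (c mod m)) = f (a mod m) + (\<Sum>c=Suc a..<a + m. f (c mod m))"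
      by (simp add: sum.atLeast_Suc_lessThan)
    moreover have "(\<Sum>c=Suc a..<Suc a + m. f (c mod m))
        = (\<Sum>c=Suc a..<a + m. f (c mod m)) + f (a mod m)"
      using False by (simp add: sum.atLeastLessThan_Suc)
    ultimately show ?thesis using Suc by simp
  qed simp
qed

lemma sum_mod_periods:
  fixes f :: "nat \<Rightarrow> nat"
  shows "(\<Sum>c=a..<a + m * K. f ((r + c) mod m)) = K * (\<Sum>k<m. f k)"
proof (induction K)
  case (Suc K)
  have "(\<Sum>c=a..<a + m * Suc K. f ((r + c) mod m))
      = (\<Sum>c=a..<a + m * K. f ((r + c) mod m))
        + (\<Sum>c=a + m * K..<a + m * K + m. f ((r + c) mod m))"
    by (subst sum.atLeastLessThan_concat) (auto simp: algebra_simps)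
  also have "(\<Sum>c=a + m * K..<a + m * K + m. f ((r + c) mod m))
      = (\<Sum>c=r + (a + m * K)..<r + (a + m * K) + m. f (c mod m))"
    using sum.shift_bounds_nat_ivl[of "\<lambda>c. f (c mod m)" "a + m * K" r "a + m * K + m"]
    by (simp add: ac_simps)
  finally show ?case using Suc sum_mod_period[where f = f and a = "r + (a + m * K)" and m = m] by simp
qed simp

lemma sum_mod_period_lessThan:
  fixes f :: "nat \<Rightarrow> nat"
  shows "(\<Sum>c<m. f ((r + c) mod m)) = (\<Sum>k<m. f k)"
  using sum_mod_periods[of f r m 0 1] by (simp add: lessThan_atLeast0)

lemma sum_lessThan_split:
  fixes f :: "nat \<Rightarrow> nat"
  shows "(\<Sum>c<B + M. f c) = (\<Sum>c<B. f c) + (\<Sum>c=B..<B + M. f c)"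
  by (simp add: lessThan_atLeast0 sum.atLeastLessThan_concat)

lemma sum_of_bool_nth:
  "(\<Sum>k<length bs. of_bool (P (bs ! k))) = size {#b \<in># mset bs. P b#}"
proof -
  have "size {#b \<in># mset bs. P b#} = length (filter P bs)"
    by (metis mset_filter size_mset)
  also have "\<dots> = card {k. k < length bs \<and> P (bs ! k)}"
    by (rule length_filter_conv_card)
  also have "\<dots> = (\<Sum>k<length bs. of_bool (P (bs ! k)))"
    by (simp add: Int_def)
  finally show ?thesis by simp
qed

section \<open>The square of a point\<close>

text \<open>Listing the blocks gives repeated blocks separate indices. The index
  \<open>r + c\<close> makes the array symmetric, so column sums reduce to row sums. It need not be
  shifted back in the bottom right corner, since any \<open>V * R\<close> consecutive integers meet
  each residue modulo \<open>V\<close> exactly \<open>R\<close> times.\<close>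

definition point_entry :: "'a set list \<Rightarrow> nat \<Rightarrow> ('a \<Rightarrow> nat) \<Rightarrow> 'a \<Rightarrow> nat \<Rightarrow> nat \<Rightarrow> nat" where
  "point_entry bs V h x r c =
    (if r < length bs \<and> c < length bs then of_bool (x \<in> bs ! ((r + c) mod length bs))
     else if length bs \<le> r \<and> length bs \<le> c then of_bool ((r + c) mod V = h x)
     else 0)"

definition point_square :: "'a set list \<Rightarrow> nat \<Rightarrow> nat \<Rightarrow> ('a \<Rightarrow> nat) \<Rightarrow> 'a \<Rightarrow> nat mat" where
  "point_square bs V R h x =
    mat (length bs + V * R) (length bs + V * R) (\<lambda>(r, c). point_entry bs V h x r c)"

lemma point_entry_commute: "point_entry bs V h x r c = point_entry bs V h x c r"
  by (auto simp: point_entry_def add.commute)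

text \<open>An upper row runs through every block once. A lower row runs through \<open>R\<close>
  full periods of the classes, each period meeting the class of \<open>x\<close> once.\<close>

lemma sum_point_entry:
  assumes "r < length bs + V * R" and "h x < V" and "size {#b \<in># mset bs. x \<in> b#} = R"
  shows "(\<Sum>c<length bs + V * R. point_entry bs V h x r c) = R"
proof (cases "r < length bs")
  case True
  then have "(\<Sum>c<length bs. point_entry bs V h x r c)
      = (\<Sum>c<length bs. of_bool (x \<in> bs ! ((r + c) mod length bs)))"
    by (intro sum.cong) (auto simp: point_entry_def)
  also have "\<dots> = R"
    using sum_mod_period_lessThan[of "\<lambda>k. of_bool (x \<in> bs ! k)" r "length bs"]
      sum_of_bool_nth[of "\<lambda>b. x \<in> b" bs] assms(3) by simp
  finally have "(\<Sum>c<length bs. point_entry bs V h x r c) = R" .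
  moreover have "(\<Sum>c=length bs..<length bs + V * R. point_entry bs V h x r c) = 0"
    using True by (simp add: point_entry_def)
  ultimately show ?thesis by (simp add: sum_lessThan_split)
next
  case False
  then have "(\<Sum>c=length bs..<length bs + V * R. point_entry bs V h x r c)
      = (\<Sum>c=length bs..<length bs + V * R. of_bool ((r + c) mod V = h x))"
    by (intro sum.cong) (auto simp: point_entry_def)
  also have "\<dots> = R * (\<Sum>k<V. of_bool (k = h x))"
    by (rule sum_mod_periods)
  also have "(\<Sum>k<V. of_bool (k = h x)) = (1::nat)"
    using assms(2) by (simp add: of_bool_def)
  finally show ?thesis using False by (simp add: sum_lessThan_split point_entry_def)
qed

lemma frequency_square_point_square:
  assumes "N = length bs + V * R" "0 < R" "R < N" "h x < V" "size {#b \<in># mset bs. x \<in> b#} = R"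
  shows "frequency_square N [N - R, R] (point_square bs V R h x)"
proof -
  have "(\<Sum>r<length bs + V * R. point_entry bs V h x r c) = R" if "c < length bs + V * R" for c
    using sum_point_entry[of c bs V R h x] that assms by (simp add: point_entry_commute[of _ _ _ _ _ c])
  then show ?thesis
    using assms sum_point_entry[of _ bs V R h x]
    by (subst binary_frequency_square_iff) (auto simp: point_square_def point_entry_def)
qed

text \<open>Distinct classes are disjoint, so only the top left corner contributes, and each of its
  rows runs through every block once.\<close>

lemma sum_point_entry_mult:
  assumes "h x \<noteq> h y"
  shows "(\<Sum>r<length bs + M. \<Sum>c<length bs + M. point_entry bs V h x r c * point_entry bs V h y r c)
    = size {#b \<in># mset bs. x \<in> b \<and> y \<in> b#} * length bs"
proof -
  let ?B = "length bs"
  let ?g = "\<lambda>r c. point_entry bs V h x r c * point_entry bs V h y r c"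
  have "(\<Sum>c<?B + M. ?g r c) = size {#b \<in># mset bs. x \<in> b \<and> y \<in> b#}" if "r < ?B" for r
  proof -
    have "(\<Sum>c<?B. ?g r c) = (\<Sum>c<?B. of_bool (x \<in> bs ! ((r + c) mod ?B) \<and> y \<in> bs ! ((r + c) mod ?B)))"
      using that by (intro sum.cong) (auto simp: point_entry_def)
    also have "\<dots> = size {#b \<in># mset bs. x \<in> b \<and> y \<in> b#}"
      using sum_mod_period_lessThan[of "\<lambda>k. of_bool (x \<in> bs ! k \<and> y \<in> bs ! k)" r ?B]
        sum_of_bool_nth[of "\<lambda>b. x \<in> b \<and> y \<in> b" bs] by simp
    finally show ?thesis
      using that by (simp add: sum_lessThan_split point_entry_def)
  qed
  moreover have "(\<Sum>c<?B + M. ?g r c) = 0" if "?B \<le> r" for r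
    using that assms by (auto simp: point_entry_def)
  ultimately show ?thesis
    by (subst sum_lessThan_split) (simp add: mult.commute)
qed

text \<open>A block is counted once per point in it, and for \<open>0 < V\<close> the bijection
  \<open>h\<close> puts each bottom right cell in the class of exactly one point.\<close>

lemma sum_points_point_entry:
  assumes "finite \<V>" "bij_betw h \<V> {..<V}" and "\<forall>b\<in>set bs. b \<subseteq> \<V>"
  shows "(\<Sum>x\<in>\<V>. point_entry bs V h x r c) =
    (if r < length bs \<and> c < length bs then card (bs ! ((r + c) mod length bs))
     else if length bs \<le> r \<and> length bs \<le> c \<and> 0 < V then 1 else 0)"
proof -
  have "(\<Sum>x\<in>\<V>. of_bool (k mod V = h x)) = (1::nat)" if "0 < V" for k
  proof -
    have "(\<Sum>x\<in>\<V>. of_bool (k mod V = h x)) = (\<Sum>j<V. of_bool (k mod V = j) :: nat)"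
      by (rule sum.reindex_bij_betw[OF assms(2)])
    then show ?thesis using that by (simp add: of_bool_def)
  qed
  moreover have "(\<Sum>x\<in>\<V>. of_bool (x \<in> bs ! k)) = card (bs ! k)" if "k < length bs" for k
  proof -
    have "\<V> \<inter> bs ! k = bs ! k" using assms(3) that by (meson inf.absorb2 nth_mem)
    then show ?thesis using assms(1) by (simp add: Int_def)
  qed
  moreover have "V = 0 \<Longrightarrow> \<V> = {}" using assms(2) by (simp add: bij_betw_def)
  moreover have "(r + c) mod length bs < length bs" if "r < length bs"
    using that by (intro mod_less_divisor) linarith
  ultimately show ?thesis by (auto simp: point_entry_def)
qed

section \<open>Maximality\<close>

lemma dvd_of_orthogonal_to_all_points:
  fixes g :: "nat \<Rightarrow> nat \<Rightarrow> nat"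
  assumes "finite \<V>" "bij_betw h \<V> {..<V}" "0 < V" and "\<forall>b\<in>set bs. b \<subseteq> \<V>"
    and w: "\<forall>b\<in>set bs. w dvd card b + 1"
    and N: "N = length bs + V * R"
    and row: "\<And>r. r < N \<Longrightarrow> (\<Sum>c<N. g r c) = R"
    and col: "\<And>c. c < N \<Longrightarrow> (\<Sum>r<N. g r c) = R"
    and orth: "\<And>x. x \<in> \<V> \<Longrightarrow> (\<Sum>r<N. \<Sum>c<N. g r c * point_entry bs V h x r c) = R * R"
  shows "w dvd R * length bs"
proof -
  let ?B = "length bs"
  let ?s = "\<lambda>r c. \<Sum>x\<in>\<V>. point_entry bs V h x r c"
  let ?k = "\<lambda>r c. card (bs ! ((r + c) mod ?B))"
  define T where "T = (\<Sum>r<?B. \<Sum>c<?B. g r c * ?k r c)"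
  define a where "a = (\<Sum>r<?B. \<Sum>c<?B. g r c)"
  \<comment> \<open>The top right corner links \<open>a\<close> and \<open>D\<close>: it completes
    the upper rows with the former and the right-hand columns with the latter.\<close>
  define u where "u = (\<Sum>r<?B. \<Sum>c=?B..<N. g r c)"
  define D where "D = (\<Sum>r=?B..<N. \<Sum>c=?B..<N. g r c)"
  note s = sum_points_point_entry[OF assms(1,2,4)]
  have "card \<V> = V" using assms(2) by (simp add: bij_betw_same_card)
  then have "V * (R * R) = (\<Sum>x\<in>\<V>. \<Sum>r<N. \<Sum>c<N. g r c * point_entry bs V h x r c)"
    using orth by simp
  also have "\<dots> = (\<Sum>r<N. \<Sum>x\<in>\<V>. \<Sum>c<N. g r c * point_entry bs V h x r c)"
    by (rule sum.swap)
  also have "\<dots> = (\<Sum>r<N. \<Sum>c<N. \<Sum>x\<in>\<V>. g r c * point_entry bs V h x r c)"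
    by (intro sum.cong refl sum.swap)
  also have "\<dots> = (\<Sum>r<N. \<Sum>c<N. g r c * ?s r c)"
    by (simp add: sum_distrib_left)
  also have "\<dots> = T + D"
    unfolding T_def D_def N s using assms(3) by (simp add: sum_lessThan_split)
  finally have total: "V * (R * R) = T + D" .
  have "?B * R = (\<Sum>r<?B. \<Sum>c<N. g r c)"
    using row N by simp
  also have "\<dots> = a + u"
    unfolding a_def u_def N by (simp add: sum_lessThan_split sum.distrib)
  finally have top: "?B * R = a + u" .
  have "V * R * R = (\<Sum>c=?B..<N. \<Sum>r<N. g r c)"
    using col N by simp
  also have "\<dots> = (\<Sum>r<N. \<Sum>c=?B..<N. g r c)"
    by (rule sum.swap)
  also have "\<dots> = u + D"
    unfolding u_def D_def N by (simp add: sum_lessThan_split)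
  finally have right: "V * R * R = u + D" .
  \<comment> \<open>Comparing \<open>total\<close> with \<open>right\<close> gives
    \<open>T = u\<close>, and \<open>top\<close> then yields the equation.\<close>
  from total top right have "R * ?B = T + a" by (simp add: algebra_simps)
  also have "\<dots> = (\<Sum>r<?B. \<Sum>c<?B. g r c * (?k r c + 1))"
    unfolding T_def a_def by (simp add: sum.distrib)
  also have "w dvd \<dots>"
  proof (intro dvd_sum dvd_mult)
    fix r c assume "r \<in> {..<?B}"
    then have "(r + c) mod ?B < ?B" by (intro mod_less_divisor) auto
    then show "w dvd ?k r c + 1" using w nth_mem by blast
  qed
  finally show ?thesis .
qed

text \<open>Double counting of incident point-block pairs.\<close>

lemma sum_list_card_blocks:
  assumes "finite \<V>" and "\<forall>b\<in>set bs. b \<subseteq> \<V>"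
    and "\<forall>x\<in>\<V>. size {#b \<in># mset bs. x \<in> b#} = R"
  shows "(\<Sum>b\<leftarrow>bs. card b) = card \<V> * R"
proof -
  have "(\<Sum>b\<leftarrow>bs. card b) = (\<Sum>k<length bs. card (bs ! k))"
    by (simp add: sum_list_sum_nth lessThan_atLeast0)
  also have "\<dots> = (\<Sum>k<length bs. \<Sum>x\<in>\<V>. of_bool (x \<in> bs ! k))"
  proof (rule sum.cong)
    fix k assume "k \<in> {..<length bs}"
    then have "\<V> \<inter> bs ! k = bs ! k" using assms(2) by (meson inf.absorb2 nth_mem lessThan_iff)
    then show "card (bs ! k) = (\<Sum>x\<in>\<V>. of_bool (x \<in> bs ! k))"
      using assms(1) by (simp add: Int_def)
  qed simp
  also have "\<dots> = (\<Sum>x\<in>\<V>. \<Sum>k<length bs. of_bool (x \<in> bs ! k))"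
    by (rule sum.swap)
  also have "\<dots> = (\<Sum>x\<in>\<V>. R)"
    using assms(3) by (intro sum.cong refl) (metis sum_of_bool_nth)
  finally show ?thesis by simp
qed

theorem theorem5p2:
  fixes R \<Lambda> w V B :: nat
    and \<V> :: "'a set"
    and \<B> :: "'a set multiset"
  assumes "0 < R" and "0 < \<Lambda>" and "0 < w"
    and "DK_design R \<Lambda> \<V> \<B>"
    and "card \<V> = V"
    and "size \<B> = B"
    and "\<forall>b\<in>#\<B>. [card b = w - 1] (mod w)"
    and "\<not> w dvd R * B \<or> \<not> w dvd B\<^sup>2"
  shows "\<exists>S. card S = V \<and>
           (\<forall>F\<in>S. frequency_square (B + V * R) [B + V * R - R, R] F) \<and>
           type_maximal (B + V * R) S"
proof -
  obtain bs where bs: "mset bs = \<B>" using ex_mset by blast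
  have B: "length bs = B" using assms(6) bs by auto
  have fin: "finite \<V>" and sub: "\<forall>b\<in>set bs. b \<subseteq> \<V>"
    and pairs: "\<And>x y. x \<in> \<V> \<Longrightarrow> y \<in> \<V> \<Longrightarrow> x \<noteq> y \<Longrightarrow> size {#b \<in># mset bs. x \<in> b \<and> y \<in> b#} = \<Lambda>"
    and repl: "\<forall>x\<in>\<V>. size {#b \<in># mset bs. x \<in> b#} = R"
    and RB: "R * R = \<Lambda> * B"
    using assms(4,6) bs by (auto simp: DK_design_def design_def power2_eq_square)
  obtain h where h: "bij_betw h \<V> {..<V}"
    using ex_bij_betw_finite_nat[OF fin] assms(5) by (auto simp: lessThan_atLeast0)
  have hV: "h x < V" if "x \<in> \<V>" for x using h that by (auto simp: bij_betw_def)
  define N where "N = B + V * R"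
  have "0 < B" using RB assms(1) by (metis gr0I mult_0_right mult_pos_pos less_irrefl)
  \<comment> \<open>The bound \<open>R \<le> V * R\<close> requires a point, so the facts about
    squares below are stated for a given point.\<close>
  have RN: "R < N" if "0 < V"
  proof -
    have "R \<le> V * R" using that by simp
    with \<open>0 < B\<close> show ?thesis unfolding N_def by linarith
  qed
  have RN': "R < N" if "x \<in> \<V>" for x using RN hV[OF that] by simp
  let ?F = "point_square bs V R h"
  have entry: "?F x $$ (r, c) = point_entry bs V h x r c" if "r < N" "c < N" for x r c
    using that by (simp add: point_square_def N_def B)
  have fs: "frequency_square N [N - R, R] (?F x)" if "x \<in> \<V>" for x
    using that RN'[OF that] hV repl assms(1)
    by (intro frequency_square_point_square) (auto simp: N_def B)
  have prod: "(\<Sum>r<N. \<Sum>c<N. ?F x $$ (r, c) * ?F y $$ (r, c)) = R * R"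
    if "x \<in> \<V>" "y \<in> \<V>" "x \<noteq> y" for x y
  proof -
    have "h x \<noteq> h y" using h that by (auto simp: bij_betw_def inj_on_def)
    from sum_point_entry_mult[where bs = bs and M = "V * R" and V = V, of h, OF this] pairs[OF that] RB
    show ?thesis by (simp add: entry) (simp add: N_def B)
  qed
  \<comment> \<open>If two points shared a square, \<open>prod\<close> would give it
    \<open>R * R\<close> ones in common with itself, but it has \<open>N * R\<close> ones and
    \<open>R < N\<close>.\<close>
  have inj: "inj_on ?F \<V>"
  proof (rule inj_onI, rule ccontr)
    fix x y assume xy: "x \<in> \<V>" "y \<in> \<V>" "?F x = ?F y" "x \<noteq> y"
    note F = fs[OF xy(1), unfolded binary_frequency_square_iff[OF assms(1) RN'[OF xy(1)]]]
    have "R * R = (\<Sum>r<N. \<Sum>c<N. ?F x $$ (r, c) * ?F x $$ (r, c))"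
      using prod[OF xy(1,2,4)] xy(3) by simp
    also have "\<dots> = (\<Sum>r<N. \<Sum>c<N. ?F x $$ (r, c))"
      using F by (intro sum.cong refl) (auto simp: le_Suc_eq)
    also have "\<dots> = N * R" using F by simp
    finally show False using RN'[OF xy(1)] assms(1) by simp
  qed
  let ?S = "?F ` \<V>"
  have mutual: "mutually_orthogonal_fs N ?S"
    unfolding mutually_orthogonal_fs_def pairwise_def
  proof (intro conjI ballI impI)
    show "finite ?S" using fin by simp
    show "\<exists>\<mu>. frequency_square N \<mu> F" if "F \<in> ?S" for F using that fs by blast
    fix F G assume "F \<in> ?S" "G \<in> ?S" "F \<noteq> G"
    then obtain x y where xy: "x \<in> \<V>" "y \<in> \<V>" "x \<noteq> y" "F = ?F x" "G = ?F y" by blast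
    then show "fs_orthogonal N F G"
      using binary_orthogonal_iff[OF assms(1) RN'[OF xy(1)] fs fs] prod by blast
  qed
  have w1: "w dvd card b + 1" if "b \<in> set bs" for b
  proof -
    have "[card b = w - 1] (mod w)" using assms(7) bs that by auto
    then have "[card b + 1 = w - 1 + 1] (mod w)" by (rule cong_add) simp
    \<comment> \<open>By \<open>0 < w\<close>, the truncated \<open>w - 1 + 1\<close> equals
      \<open>w\<close>.\<close>
    then show ?thesis using assms(3) by (simp add: cong_def mod_eq_0_iff_dvd)
  qed
  have "w dvd (\<Sum>b\<leftarrow>bs. card b + 1)"
    using w1 by (induction bs) (auto simp del: One_nat_def)
  also have "(\<Sum>b\<leftarrow>bs. card b + 1) = N"
    using sum_list_card_blocks[OF fin sub repl] B assms(5)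
    by (simp add: sum_list_Suc N_def)
  finally have wNB: "w dvd N * B" by simp
  \<comment> \<open>Since \<open>w\<close> divides \<open>N * B\<close>, divisibility of
    \<open>R * B\<close> would force that of \<open>B\<^sup>2\<close>, so the disjunctive hypothesis
    reduces to its first alternative.\<close>
  have "w dvd B\<^sup>2" if "w dvd R * B"
  proof -
    have "N * B = V * (R * B) + B\<^sup>2" by (simp add: N_def power2_eq_square algebra_simps)
    with wNB that show ?thesis by (metis dvd_add_right_iff dvd_mult)
  qed
  with assms(8) have ndvd: "\<not> w dvd R * B" by blast
  have "\<not> (\<exists>G \<mu>. frequency_square N \<mu> G \<and> (\<exists>H\<in>?S. frequency_square N \<mu> H) \<and>
            (\<forall>H\<in>?S. fs_orthogonal N G H))"
  proof
    assume "\<exists>G \<mu>. frequency_square N \<mu> G \<and> (\<exists>H\<in>?S. frequency_square N \<mu> H) \<and>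
            (\<forall>H\<in>?S. fs_orthogonal N G H)"
    \<comment> \<open>The member sharing the type of \<open>G\<close> supplies a point
      \<open>x\<close>, which gives both \<open>0 < V\<close> and \<open>R < N\<close>.\<close>
    then obtain G \<mu> x where G: "frequency_square N \<mu> G" and x: "x \<in> \<V>"
      and Fx: "frequency_square N \<mu> (?F x)" and orth: "\<And>y. y \<in> \<V> \<Longrightarrow> fs_orthogonal N G (?F y)"
      by blast
    have \<mu>: "\<mu> = [N - R, R]" using frequency_square_type_unique[OF Fx fs[OF x]] .
    note bin = assms(1) RN'[OF x]
    note G' = G[unfolded \<mu>]
    have "w dvd R * length bs"
    proof (rule dvd_of_orthogonal_to_all_points[OF fin h _ sub, where g = "\<lambda>r c. G $$ (r, c)"])
      show "0 < V" using hV[OF x] by simp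
      show "\<forall>b\<in>set bs. w dvd card b + 1" using w1 by blast
      show "N = length bs + V * R" by (simp add: N_def B)
      show "(\<Sum>c<N. G $$ (r, c)) = R" if "r < N" for r
        using G'[unfolded binary_frequency_square_iff[OF bin]] that by blast
      show "(\<Sum>r<N. G $$ (r, c)) = R" if "c < N" for c
        using G'[unfolded binary_frequency_square_iff[OF bin]] that by blast
      show "(\<Sum>r<N. \<Sum>c<N. G $$ (r, c) * point_entry bs V h y r c) = R * R" if "y \<in> \<V>" for y
        using binary_orthogonal_iff[OF bin G' fs[OF that]] orth[OF that] by (simp add: entry)
    qed
    with ndvd B show False by simp
  qed
  with mutual have "type_maximal N ?S" by (simp add: type_maximal_def)
  moreover have "card ?S = V" using card_image[OF inj] assms(5) by simp
  ultimately show ?thesis using fs unfolding N_def by blast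
qed

end
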